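(* If $H$ is a vertex-minor of a graph $G$, then $\mathbb{E}\rho(H)\le\mathbb{E}\rho(G)$. In addition, if $V(G)\setminus V(H)$ contains at least one vertex that is not isolated in $G$, then $\mathbb{E}\rho(H)\le\mathbb{E}\rho(G)-2^{-|V(H)|}$.
   Context: Graphs are finite and simple. $\rho_G(X)$ is the binary rank of the $X\times(V(G)\setminus X)$ adjacency submatrix; $\mathbb{E}\rho(G)=2^{-|V(G)|}\sum_{S\subseteq V(G)}\rho_G(S)$. Local complementation at $v$ replaces the induced subgraph on the neighborhood of $v$ by its complement; $H$ is a vertex-minor of $G$ if $H$ is an induced subgraph of a graph obtained from $G$ by a sequence of local complementations.
   Formalization: The second inequality is stated only for H with at least one vertex; for H the null graph it fails, e.g. for G = K_2, where it would read 0 ≤ 1/2 − 1. *)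

theory Defs
  imports
    Complex_Main
    "HOL-Library.Z2"
    "HOL-Library.Function_Algebras"
    "Graph_Theory.Digraph_Component"
begin

text \<open>
  Finite simple graphs are \<^locale>\<open>pair_graph\<close>s: finite, loopless digraphs without parallel arcs
  whose arc set is symmetric, so an edge $uv$ is the pair of arcs $(u,v)$, $(v,u)$. The graph
  without vertices is included.
\<close>

definition neighborhood :: "'a pair_pre_digraph \<Rightarrow> 'a \<Rightarrow> 'a set" where
  "neighborhood G v = {u. (v, u) \<in> parcs G}"

definition isolated :: "'a pair_pre_digraph \<Rightarrow> 'a \<Rightarrow> bool" where
  "isolated G v \<longleftrightarrow> v \<in> pverts G \<and> neighborhood G v = {}"

definition local_complement :: "'a pair_pre_digraph \<Rightarrow> 'a \<Rightarrow> 'a pair_pre_digraph" where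
  "local_complement G v =
    (let N = neighborhood G v in
     \<lparr> pverts = pverts G,
       parcs = (parcs G - N \<times> N) \<union> {(x, y). x \<in> N \<and> y \<in> N \<and> x \<noteq> y \<and> (x, y) \<notin> parcs G} \<rparr>)"

inductive locally_equivalent :: "'a pair_pre_digraph \<Rightarrow> 'a pair_pre_digraph \<Rightarrow> bool"
  for G :: "'a pair_pre_digraph" where
  refl: "locally_equivalent G G"
| step: "locally_equivalent G G' \<Longrightarrow> v \<in> pverts G' \<Longrightarrow>
    locally_equivalent G (local_complement G' v)"

text \<open>
  Vertex-minors are labelled: they live on a subset of the vertices of \<open>G\<close>.
\<close>

definition vertex_minor :: "'a pair_pre_digraph \<Rightarrow> 'a pair_pre_digraph \<Rightarrow> bool" where
  "vertex_minor H G \<longleftrightarrow>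
    (\<exists>G'. locally_equivalent G G' \<and> induced_subgraph (with_proj H) (with_proj G'))"

text \<open>
  Matrices over the two-element field \<^typ>\<open>bit\<close> are indexed by arbitrary sets, and their rank is
  the dimension of the row space. A row of the submatrix with columns \<open>Y\<close> is a vector indexed by
  \<open>Y\<close>, represented as a function that vanishes outside \<open>Y\<close>.
\<close>

definition bit_scale :: "bit \<Rightarrow> ('a \<Rightarrow> bit) \<Rightarrow> 'a \<Rightarrow> bit" where
  "bit_scale c f = (\<lambda>x. c * f x)"

interpretation bitvec: vector_space bit_scale
  by unfold_locales (auto simp: bit_scale_def fun_eq_iff algebra_simps)

definition submatrix_row :: "('r \<Rightarrow> 'c \<Rightarrow> bit) \<Rightarrow> 'c set \<Rightarrow> 'r \<Rightarrow> 'c \<Rightarrow> bit" where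
  "submatrix_row M Y x = (\<lambda>y. if y \<in> Y then M x y else 0)"

definition binary_rank :: "('r \<Rightarrow> 'c \<Rightarrow> bit) \<Rightarrow> 'r set \<Rightarrow> 'c set \<Rightarrow> nat" where
  "binary_rank M X Y = bitvec.dim (submatrix_row M Y ` X)"

definition adjacency :: "'a pair_pre_digraph \<Rightarrow> 'a \<Rightarrow> 'a \<Rightarrow> bit" where
  "adjacency G u v = of_bool ((u, v) \<in> parcs G)"

definition cut_rank :: "'a pair_pre_digraph \<Rightarrow> 'a set \<Rightarrow> nat" where
  "cut_rank G X = binary_rank (adjacency G) X (pverts G - X)"

definition expected_cut_rank :: "'a pair_pre_digraph \<Rightarrow> real" where
  "expected_cut_rank G =
    (\<Sum>S\<in>Pow (pverts G). real (cut_rank G S)) / 2 ^ card (pverts G)"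

end

theory Submission
  imports Defs
begin

text \<open>
  Local complementation at \<open>v\<close> acts on the cut matrix of \<open>S\<close> by adding row \<open>v\<close> to other rows
  (if \<open>v \<in> S\<close>) or column \<open>v\<close> to other columns (if \<open>v \<notin> S\<close>), so it does not increase the
  cut-rank; deleting vertices deletes rows and columns. Averaging over \<open>S\<close> gives the first inequality.
  For the gain, let \<open>H\<close> live on \<open>W\<close>, let \<open>B\<close> avoid \<open>W\<close>, and consider the cuts \<open>B\<close> and \<open>W \<union> B\<close>,
  which are trivial in \<open>H\<close>. If \<open>v \<notin> W\<close> has a neighbor \<open>w\<close>, the arc between \<open>v\<close> and \<open>w\<close>
  crosses one of \<open>S\<close> and \<open>S \<union> {v}\<close> for every \<open>S\<close> not containing \<open>v\<close>, so at least half of these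
  cuts have positive rank in \<open>G\<close>.
\<close>

section \<open>Dimension and binary rank\<close>

context vector_space
begin

text \<open>Finiteness of \<open>B\<close> matters: \<open>dim\<close> is the cardinality of a
  basis, hence 0 for an infinite-dimensional span.\<close>

lemma dim_mono_finite:
  assumes "A \<subseteq> span B" and "finite B"
  shows "dim A \<le> dim B"
proof -
  obtain C where "C \<subseteq> B" "B \<subseteq> span C" "card C = dim B"
    using basis_exists[of B] by metis
  moreover from this have "A \<subseteq> span C"
    using assms(1) span_mono span_span by (metis order_trans)
  ultimately show ?thesis
    using dim_le_card[of A C] assms(2) finite_subset by metis
qed

end

context vector_space_pair
begin

lemma dim_image_le_finite:
  assumes f: "Vector_Spaces.linear s1 s2 f" and "finite A"
  shows "vs2.dim (f ` A) \<le> vs1.dim A"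
proof -
  obtain C where C: "C \<subseteq> A" "A \<subseteq> vs1.span C" "card C = vs1.dim A"
    using vs1.basis_exists[of A] by metis
  have fin: "finite C"
    using C(1) assms(2) finite_subset by blast
  have "f ` A \<subseteq> vs2.span (f ` C)"
    using C(2) linear_span_image[OF f] by blast
  then have "vs2.dim (f ` A) \<le> card (f ` C)"
    using fin by (intro vs2.dim_le_card) auto
  then show ?thesis
    using card_image_le[OF fin, of f] C(3) by simp
qed

end

interpretation bitvec_pair: vector_space_pair bit_scale bit_scale
  by unfold_locales

lemma bitvec_linearI:
  assumes "\<And>f g. T (f + g) = T f + T g" and "\<And>c f. T (bit_scale c f) = bit_scale c (T f)"
  shows "Vector_Spaces.linear bit_scale bit_scale T"
  using assms by unfold_locales

text \<open>Adding columns to one another and deleting columns act on every row by one linear map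
  \<open>T\<close>, while deleting rows shrinks \<open>X\<close> to \<open>X'\<close>. So this
  covers both column operations and passage to submatrices.\<close>

lemma binary_rank_le_by_linear:
  assumes "Vector_Spaces.linear bit_scale bit_scale T" and "finite X" and "X' \<subseteq> X"
    and "\<And>x. x \<in> X' \<Longrightarrow> submatrix_row M' Y' x = T (submatrix_row M Y x)"
  shows "binary_rank M' X' Y' \<le> binary_rank M X Y"
proof -
  have "submatrix_row M' Y' ` X' \<subseteq> T ` submatrix_row M Y ` X"
    using assms(3,4) by auto
  then have "binary_rank M' X' Y' \<le> bitvec.dim (T ` submatrix_row M Y ` X)"
    unfolding binary_rank_def using assms(2)
    by (intro bitvec.dim_mono_finite order_trans[OF _ bitvec.span_superset]) auto
  also have "\<dots> \<le> binary_rank M X Y"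
    unfolding binary_rank_def using assms(1,2) by (intro bitvec_pair.dim_image_le_finite) auto
  finally show ?thesis .
qed

lemma binary_rank_pos:
  assumes "finite X" and "x \<in> X" and "y \<in> Y" and "M x y \<noteq> 0"
  shows "1 \<le> binary_rank M X Y"
proof -
  have "submatrix_row M Y x \<noteq> 0"
    using assms(3,4) by (auto simp: submatrix_row_def fun_eq_iff)
  then have "bitvec.dim {submatrix_row M Y x} = 1"
    using bitvec.dim_eq_card_independent[of "{submatrix_row M Y x}"] by simp
  moreover have "bitvec.dim {submatrix_row M Y x} \<le> binary_rank M X Y"
    unfolding binary_rank_def using assms(1,2)
    by (intro bitvec.dim_mono_finite) (auto intro: bitvec.span_base)
  ultimately show ?thesis by simp
qed

lemma binary_rank_no_rows: "binary_rank M {} Y = 0"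
  using bitvec.dim_le_card[of "{}" "{}"] by (simp add: binary_rank_def)

lemma binary_rank_no_columns: "binary_rank M X {} = 0"
proof -
  have "submatrix_row M {} ` X \<subseteq> bitvec.span {}"
    by (auto simp: submatrix_row_def fun_eq_iff)
  then show ?thesis
    using bitvec.dim_le_card[of "submatrix_row M {} ` X" "{}"] by (simp add: binary_rank_def)
qed

section \<open>Simple graphs and local complementation\<close>

lemma pair_graph_symD: "pair_graph G \<Longrightarrow> (x, y) \<in> parcs G \<Longrightarrow> (y, x) \<in> parcs G"
  using pair_sym_digraph.pair_sym_arcs[of G]
  by (auto simp: pair_graph_def pair_pseudo_graph_def symmetric_def dest: symD)

lemma pair_graph_irrefl: "pair_graph G \<Longrightarrow> (x, x) \<notin> parcs G"
  using pair_loopfree_digraph.pair_no_loops[of G "(x, x)"]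
  by (auto simp: pair_graph_def pair_digraph_def)

lemma pair_graph_arc_verts:
  assumes "pair_graph G" and "(x, y) \<in> parcs G"
  shows "x \<in> pverts G" and "y \<in> pverts G"
  using assms pair_wf_digraph.arc_fst_in_verts[of G "(x, y)"]
    pair_wf_digraph.arc_snd_in_verts[of G "(x, y)"]
  by (auto simp: pair_graph_def pair_digraph_def pair_fin_digraph_def)

lemma pair_graph_finite_verts: "pair_graph G \<Longrightarrow> finite (pverts G)"
  using pair_fin_digraph.pair_finite_verts[of G] by (auto simp: pair_graph_def pair_digraph_def)

lemma pverts_local_complement [simp]: "pverts (local_complement G v) = pverts G"
  by (simp add: local_complement_def Let_def)

lemma parcs_local_complement:
  "(x, y) \<in> parcs (local_complement G v) \<longleftrightarrow>
    (if x \<in> neighborhood G v \<and> y \<in> neighborhood G v then x \<noteq> y \<and> (x, y) \<notin> parcs G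
     else (x, y) \<in> parcs G)"
  by (auto simp: local_complement_def Let_def)

lemma pair_graph_local_complement:
  assumes G: "pair_graph G"
  shows "pair_graph (local_complement G v)"
proof -
  have wf: "x \<in> pverts G \<and> y \<in> pverts G" if "(x, y) \<in> parcs (local_complement G v)" for x y
    using that pair_graph_arc_verts[OF G]
    by (auto simp: parcs_local_complement neighborhood_def split: if_splits)
  show ?thesis
  proof unfold_locales
    show "finite (parcs (local_complement G v))"
      using wf pair_graph_finite_verts[OF G]
      by (auto intro: rev_finite_subset[of "pverts G \<times> pverts G"])
    have "(y, x) \<in> parcs (local_complement G v)"
      if "(x, y) \<in> parcs (local_complement G v)" for x y
    proof -
      have "(y, x) \<in> parcs G \<longleftrightarrow> (x, y) \<in> parcs G"
        using pair_graph_symD[OF G] by blast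
      then show ?thesis
        using that by (auto simp: parcs_local_complement split: if_splits)
    qed
    then show "symmetric (with_proj (local_complement G v))"
      by (simp add: symmetric_def symI)
    show "fst e \<noteq> snd e" if "e \<in> parcs (local_complement G v)" for e
      using that pair_graph_irrefl[OF G]
      by (cases e) (auto simp: parcs_local_complement split: if_splits)
  qed (use wf pair_graph_finite_verts[OF G] in auto)
qed

text \<open>If \<open>u\<close> is adjacent to \<open>v\<close>, the arc from \<open>u\<close> to
  \<open>v\<close> survives because \<open>v\<close> is not its own neighbor; otherwise no arc at
  \<open>u\<close> changes.\<close>

lemma neighborhood_local_complement_nonempty:
  assumes G: "pair_graph G" and "neighborhood G u \<noteq> {}"
  shows "neighborhood (local_complement G v) u \<noteq> {}"
proof (cases "u \<in> neighborhood G v")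
  case True
  then have "(u, v) \<in> parcs (local_complement G v)"
    using pair_graph_symD[OF G] pair_graph_irrefl[OF G]
    by (auto simp: parcs_local_complement neighborhood_def)
  then show ?thesis by (auto simp: neighborhood_def)
next
  case False
  then show ?thesis
    using assms(2) by (auto simp: neighborhood_def parcs_local_complement)
qed

lemma adjacency_local_complement:
  assumes "x \<noteq> y"
  shows "adjacency (local_complement G v) x y =
    adjacency G x y + of_bool (x \<in> neighborhood G v \<and> y \<in> neighborhood G v)"
  using assms by (auto simp: adjacency_def parcs_local_complement)

lemma cut_rank_local_complement_le:
  assumes G: "pair_graph G" and v: "v \<in> pverts G" and S: "S \<subseteq> pverts G"
  shows "cut_rank (local_complement G v) S \<le> cut_rank G S"
proof -
  define N where "N = neighborhood G v"
  define Y where "Y = pverts G - S"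
  define R where "R = submatrix_row (adjacency G) Y"
  define R' where "R' = submatrix_row (adjacency (local_complement G v)) Y"
  have fin: "finite S"
    using S pair_graph_finite_verts[OF G] finite_subset by blast
  \<comment> \<open>Rows and columns of a cut matrix are disjoint, so the diagonal exception never
    occurs and the change is the rank-one matrix of
    \<open>N \<times> (N \<inter> Y)\<close>.\<close>
  have R': "R' x y = R x y + of_bool (x \<in> N \<and> y \<in> N \<inter> Y)" if "x \<in> S" for x y
  proof (cases "y \<in> Y")
    case True
    then have "x \<noteq> y"
      using that by (auto simp: Y_def)
    then show ?thesis
      using True adjacency_local_complement[of x y G v]
      by (simp add: R_def R'_def submatrix_row_def N_def)
  qed (simp add: R_def R'_def submatrix_row_def)
  have ranks: "cut_rank G S = bitvec.dim (R ` S)"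
    "cut_rank (local_complement G v) S = bitvec.dim (R' ` S)"
    by (simp_all add: cut_rank_def binary_rank_def R_def R'_def Y_def)
  show ?thesis
  proof (cases "v \<in> S")
    case True
    have "R' x \<in> bitvec.span (R ` S)" if x: "x \<in> S" for x
    proof -
      \<comment> \<open>The row \<open>R v\<close> is the indicator of \<open>N \<inter> Y\<close>,
        which is exactly what is added to the rows in \<open>N\<close>.\<close>
      have "R' x = (if x \<in> N then R x + R v else R x)"
        using R'[OF x]
        by (auto simp: fun_eq_iff R_def submatrix_row_def N_def neighborhood_def adjacency_def)
      then show ?thesis
        using x True by (auto intro: bitvec.span_add bitvec.span_base)
    qed
    then show ?thesis
      unfolding ranks using fin by (intro bitvec.dim_mono_finite) auto
  next
    case False
    \<comment> \<open>Here \<open>v \<in> Y\<close>, and column \<open>v\<close> is the indicator of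
      \<open>N\<close> on the rows. \<open>T\<close> adds the entry in column \<open>v\<close> to
      each column in \<open>N \<inter> Y\<close>.\<close>
    define T :: "('a \<Rightarrow> bit) \<Rightarrow> 'a \<Rightarrow> bit" where
      "T f = (\<lambda>y. f y + of_bool (y \<in> N \<inter> Y) * f v)" for f
    have "R x v = of_bool (x \<in> N)" for x
      using False v pair_graph_symD[OF G]
      by (auto simp: R_def submatrix_row_def Y_def N_def neighborhood_def adjacency_def)
    then have "R' x = T (R x)" if "x \<in> S" for x
      using R'[OF that] by (auto simp: T_def fun_eq_iff)
    moreover have "Vector_Spaces.linear bit_scale bit_scale T"
      by (rule bitvec_linearI) (auto simp: T_def bit_scale_def fun_eq_iff algebra_simps)
    ultimately show ?thesis
      unfolding cut_rank_def pverts_local_complement using fin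
      by (intro binary_rank_le_by_linear) (auto simp: R_def R'_def Y_def)
  qed
qed

lemma expected_cut_rank_local_complement_le:
  assumes "pair_graph G" and "v \<in> pverts G"
  shows "expected_cut_rank (local_complement G v) \<le> expected_cut_rank G"
  unfolding expected_cut_rank_def pverts_local_complement
  using cut_rank_local_complement_le[OF assms] by (intro divide_right_mono sum_mono) auto

text \<open>This reduces the theorem to an induced subgraph of \<open>G'\<close>. The last conjunct
  keeps a non-isolated vertex of \<open>G\<close> non-isolated in \<open>G'\<close>, where the gain
  is proved.\<close>

lemma locally_equivalent_invariants:
  assumes "locally_equivalent G G'" and "pair_graph G"
  shows "pair_graph G' \<and> pverts G' = pverts G \<and>
    expected_cut_rank G' \<le> expected_cut_rank G \<and>
    (\<forall>u. neighborhood G u \<noteq> {} \<longrightarrow> neighborhood G' u \<noteq> {})"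
  using assms
proof induction
  case (step G' v)
  then show ?case
    using pair_graph_local_complement expected_cut_rank_local_complement_le[of G' v]
      neighborhood_local_complement_nonempty[of G']
    by force
qed simp

section \<open>Cuts of positive rank and cuts of induced subgraphs\<close>

lemma cut_rank_pos:
  assumes "finite X" and "x \<in> X" and "y \<in> pverts G - X" and "(x, y) \<in> parcs G"
  shows "1 \<le> cut_rank G X"
  unfolding cut_rank_def using assms by (intro binary_rank_pos) (auto simp: adjacency_def)

lemma cut_rank_insert_pos:
  assumes G: "pair_graph G" and v: "neighborhood G v \<noteq> {}" "v \<notin> S" and S: "S \<subseteq> pverts G"
  shows "1 \<le> cut_rank G S + cut_rank G (insert v S)"
proof -
  obtain w where vw: "(v, w) \<in> parcs G"
    using v(1) by (auto simp: neighborhood_def)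
  have wv: "(w, v) \<in> parcs G" and ne: "w \<noteq> v" and V: "v \<in> pverts G" "w \<in> pverts G"
    using pair_graph_symD[OF G vw] pair_graph_irrefl[OF G] pair_graph_arc_verts[OF G vw] vw
    by auto
  have fin: "finite S"
    using S pair_graph_finite_verts[OF G] finite_subset by blast
  show ?thesis
  proof (cases "w \<in> S")
    case True
    then show ?thesis
      using cut_rank_pos[of S w v G] fin wv V v(2) by auto
  next
    case False
    then show ?thesis
      using cut_rank_pos[of "insert v S" v w G] fin vw V ne by auto
  qed
qed

lemma cut_rank_trivial: "cut_rank G {} = 0" "cut_rank G (pverts G) = 0"
  by (simp_all add: cut_rank_def binary_rank_no_rows binary_rank_no_columns)

text \<open>The vertices outside \<open>H\<close> may be placed on either side of the cut: as
  \<open>B\<close> misses \<open>H\<close>, the cut matrix of \<open>A\<close> in \<open>H\<close>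
  is the part of the larger one with rows \<open>A\<close> and columns in \<open>H\<close>.
  \<open>T\<close> zeroes the other columns.\<close>

lemma cut_rank_induced_le:
  assumes "pair_graph G" and H: "induced_subgraph (with_proj H) (with_proj G)"
    and A: "A \<subseteq> pverts H" and B: "B \<subseteq> pverts G - pverts H"
  shows "cut_rank H A \<le> cut_rank G (A \<union> B)"
proof -
  have W: "pverts H \<subseteq> pverts G" "parcs H = {e \<in> parcs G. fst e \<in> pverts H \<and> snd e \<in> pverts H}"
    using H by (auto simp: induced_subgraph_def subgraph_def)
  define T :: "('a \<Rightarrow> bit) \<Rightarrow> 'a \<Rightarrow> bit" where
    "T f = (\<lambda>y. of_bool (y \<in> pverts H) * f y)" for f
  have "Vector_Spaces.linear bit_scale bit_scale T"
    by (rule bitvec_linearI) (auto simp: T_def bit_scale_def fun_eq_iff algebra_simps)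
  moreover have "finite (A \<union> B)"
    using pair_graph_finite_verts[OF assms(1)] A B W(1)
    by (meson Diff_subset Un_least finite_subset order_trans)
  moreover have "submatrix_row (adjacency H) (pverts H - A) x =
      T (submatrix_row (adjacency G) (pverts G - (A \<union> B)) x)" if "x \<in> A" for x
    using that A B W by (auto simp: submatrix_row_def T_def fun_eq_iff adjacency_def)
  ultimately show ?thesis
    unfolding cut_rank_def by (intro binary_rank_le_by_linear) auto
qed

section \<open>Averaging over all cuts\<close>

lemma sum_Pow_Un_disjoint:
  assumes "U \<inter> W = {}"
  shows "(\<Sum>S\<in>Pow (W \<union> U). f S) = (\<Sum>B\<in>Pow U. \<Sum>A\<in>Pow W. f (A \<union> B))"
proof -
  have "(\<Sum>S\<in>Pow (W \<union> U). f S) = (\<Sum>(B, A)\<in>Pow U \<times> Pow W. f (A \<union> B))"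
    by (rule sum.reindex_bij_witness[of _ "\<lambda>(B, A). A \<union> B" "\<lambda>S. (S \<inter> U, S \<inter> W)"])
      (use assms in \<open>auto intro!: arg_cong[where f = f]\<close>)
  then show ?thesis by (simp add: sum.cartesian_product)
qed

lemma sum_Pow_insert:
  assumes "finite U" and "v \<notin> U"
  shows "(\<Sum>B\<in>Pow (insert v U). f B) = (\<Sum>B\<in>Pow U. f B + f (insert v B))"
proof -
  have "inj_on (insert v) (Pow U)"
    using assms(2) by (auto simp: inj_on_def)
  then show ?thesis
    unfolding Pow_insert using assms
    by (subst sum.union_disjoint) (auto simp: sum.reindex sum.distrib)
qed

text \<open>Each cut of \<open>G\<close> splits uniquely as \<open>A \<union> B\<close>, so the sum
  for \<open>H\<close> is repeated once for every \<open>B\<close>. The constant \<open>c\<close>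
  bounds from below the average over \<open>B\<close> of the total excess; the two claims use
  \<open>c = 0\<close> and \<open>c = 1\<close>.\<close>

lemma expected_cut_rank_induced:
  assumes G: "pair_graph G" and H: "induced_subgraph (with_proj H) (with_proj G)"
    and c: "c * 2 ^ card (pverts G - pverts H) \<le>
      (\<Sum>B\<in>Pow (pverts G - pverts H). \<Sum>A\<in>Pow (pverts H).
        real (cut_rank G (A \<union> B)) - real (cut_rank H A))"
  shows "expected_cut_rank H + c / 2 ^ card (pverts H) \<le> expected_cut_rank G"
proof -
  let ?V = "pverts G" and ?W = "pverts H"
  let ?U = "?V - ?W" and ?h = "\<Sum>A\<in>Pow ?W. real (cut_rank H A)"
  have W: "?W \<subseteq> ?V"
    using H by (auto simp: induced_subgraph_def subgraph_def)
  have fin: "finite ?V" "finite ?W"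
    using pair_graph_finite_verts[OF G] W finite_subset by auto
  have V: "?V = ?W \<union> ?U"
    using W by auto
  have card: "card ?V = card ?W + card ?U"
    using W fin by (simp add: card_Diff_subset card_mono)
  have "(\<Sum>S\<in>Pow ?V. real (cut_rank G S)) =
      (\<Sum>B\<in>Pow ?U. \<Sum>A\<in>Pow ?W. real (cut_rank G (A \<union> B)))"
    by (subst V, subst sum_Pow_Un_disjoint) auto
  moreover have "(\<Sum>B\<in>Pow ?U. ?h) = ?h * 2 ^ card ?U"
    using fin by (simp add: card_Pow)
  ultimately have "(?h + c) * 2 ^ card ?U \<le> (\<Sum>S\<in>Pow ?V. real (cut_rank G S))"
    using c by (simp only: sum_subtractf distrib_right)
  then have "(?h + c) * 2 ^ card ?U / (2 ^ card ?W * 2 ^ card ?U) \<le> expected_cut_rank G"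
    unfolding expected_cut_rank_def card power_add by (intro divide_right_mono) auto
  then show ?thesis
    by (simp add: expected_cut_rank_def add_divide_distrib)
qed

lemma expected_cut_rank_induced_le:
  assumes "pair_graph G" and "induced_subgraph (with_proj H) (with_proj G)"
  shows "expected_cut_rank H \<le> expected_cut_rank G"
proof -
  have "expected_cut_rank H + 0 / 2 ^ card (pverts H) \<le> expected_cut_rank G"
    using cut_rank_induced_le[OF assms]
    by (intro expected_cut_rank_induced[OF assms]) (auto intro!: sum_nonneg)
  then show ?thesis by simp
qed

lemma expected_cut_rank_induced_gain:
  assumes G: "pair_graph G" and H: "induced_subgraph (with_proj H) (with_proj G)"
    and ne: "pverts H \<noteq> {}" and v: "v \<in> pverts G - pverts H" "neighborhood G v \<noteq> {}"
  shows "expected_cut_rank H + 1 / 2 ^ card (pverts H) \<le> expected_cut_rank G"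
proof (rule expected_cut_rank_induced[OF G H])
  let ?V = "pverts G" and ?W = "pverts H"
  define U where "U = ?V - ?W - {v}"
  have U: "?V - ?W = insert v U" "v \<notin> U"
    using v(1) by (auto simp: U_def)
  have W: "?W \<subseteq> ?V"
    using H by (auto simp: induced_subgraph_def subgraph_def)
  have fin: "finite ?V" "finite ?W" "finite U"
    using pair_graph_finite_verts[OF G] W finite_subset by (auto simp: U_def)
  let ?r = "\<lambda>S. real (cut_rank G S)"
  let ?e = "\<lambda>B A. ?r (A \<union> B) - real (cut_rank H A)"
  \<comment> \<open>All excesses are nonnegative, so only the terms \<open>A = {}\<close> and
    \<open>A = ?W\<close> are kept; there the cut-rank of \<open>H\<close> is 0.\<close>
  have trivial_cuts: "?r B + ?r (?W \<union> B) \<le> (\<Sum>A\<in>Pow ?W. ?e B A)" if "B \<subseteq> ?V - ?W" for B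
  proof -
    have "(\<Sum>A\<in>{{}, ?W}. ?e B A) \<le> (\<Sum>A\<in>Pow ?W. ?e B A)"
      using fin cut_rank_induced_le[OF G H _ that] by (intro sum_mono2) auto
    \<comment> \<open>By \<open>ne\<close> the sets \<open>{}\<close> and \<open>?W\<close> differ,
      so the sum really has two terms.\<close>
    then show ?thesis
      using ne by (simp add: cut_rank_trivial)
  qed
  \<comment> \<open>Grouping \<open>B\<close> with \<open>insert v B\<close> gives two pairs of cuts
    that differ only in \<open>v\<close>, one pair from each trivial cut of \<open>H\<close>; each
    pair contributes at least 1.\<close>
  have pair: "2 \<le> (\<Sum>A\<in>Pow ?W. ?e B A) + (\<Sum>A\<in>Pow ?W. ?e (insert v B) A)"
    if "B \<in> Pow U" for B
  proof -
    have B: "B \<subseteq> ?V - ?W" "insert v B \<subseteq> ?V - ?W" "v \<notin> B"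
      using that U by auto
    have "1 \<le> cut_rank G B + cut_rank G (insert v B)"
      using cut_rank_insert_pos[OF G v(2) B(3)] B by auto
    moreover have "1 \<le> cut_rank G (?W \<union> B) + cut_rank G (insert v (?W \<union> B))"
      using cut_rank_insert_pos[OF G v(2), of "?W \<union> B"] B v(1) W by auto
    ultimately show ?thesis
      using trivial_cuts[OF B(1)] trivial_cuts[OF B(2)] by simp
  qed
  \<comment> \<open>There are \<open>2 ^ card U\<close> groups worth 2 each, and
    \<open>?V - ?W\<close> has one element more than \<open>U\<close>; hence
    \<open>c = 1\<close>.\<close>
  have "1 * 2 ^ card (?V - ?W) = (\<Sum>B\<in>Pow U. 2 :: real)"
    using fin U by (simp add: card_Pow)
  also have "\<dots> \<le> (\<Sum>B\<in>Pow U. (\<Sum>A\<in>Pow ?W. ?e B A) + (\<Sum>A\<in>Pow ?W. ?e (insert v B) A))"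
    by (rule sum_mono) (rule pair)
  also have "\<dots> = (\<Sum>B\<in>Pow (?V - ?W). \<Sum>A\<in>Pow ?W. ?e B A)"
    unfolding U(1) by (rule sum_Pow_insert[OF fin(3) U(2), symmetric])
  finally show "1 * 2 ^ card (?V - ?W) \<le> (\<Sum>B\<in>Pow (?V - ?W). \<Sum>A\<in>Pow ?W. ?e B A)" .
qed

theorem theorem4p1:
  fixes G H :: "'a pair_pre_digraph"
  assumes "pair_graph G"
    and "vertex_minor H G"
  shows "expected_cut_rank H \<le> expected_cut_rank G \<and>
    (pverts H \<noteq> {} \<and> (\<exists>v \<in> pverts G - pverts H. \<not> isolated G v) \<longrightarrow>
      expected_cut_rank H \<le> expected_cut_rank G - 1 / 2 ^ card (pverts H))"
proof -
  obtain G' where eq: "locally_equivalent G G'"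
    and H: "induced_subgraph (with_proj H) (with_proj G')"
    using assms(2) by (auto simp: vertex_minor_def)
  have G': "pair_graph G'" "pverts G' = pverts G" "expected_cut_rank G' \<le> expected_cut_rank G"
    and nb: "\<And>u. neighborhood G u \<noteq> {} \<Longrightarrow> neighborhood G' u \<noteq> {}"
    using locally_equivalent_invariants[OF eq assms(1)] by auto
  show ?thesis
  proof (intro conjI impI)
    show "expected_cut_rank H \<le> expected_cut_rank G"
      using expected_cut_rank_induced_le[OF G'(1) H] G'(3) by linarith
  next
    assume *: "pverts H \<noteq> {} \<and> (\<exists>v \<in> pverts G - pverts H. \<not> isolated G v)"
    then obtain v where "v \<in> pverts G' - pverts H" "neighborhood G' v \<noteq> {}"
      using nb G'(2) unfolding isolated_def by blast
    then show "expected_cut_rank H \<le> expected_cut_rank G - 1 / 2 ^ card (pverts H)"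
      using expected_cut_rank_induced_gain[OF G'(1) H] * G'(3) by fastforce
  qed
qed

end
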